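(* Let $H$ be a hypergraph, $W\subseteq V(H)$, and $|W|\ge 2$. The set $W$ is a unit in $H$ if and only if $0$ is an eigenvalue of $A_{G_H}$ with multiplicity at least $|W|-1$, and $W$ is a maximal subset of $V(H)$ such that $\tilde S_W$ is a subspace of the nullspace of $A_{G_H}$.
   Context: A hypergraph $H=(V(H),E(H))$ consists of a finite non-empty vertex set $V(H)$ and a set $E(H)\subseteq\mathcal{P}(V(H))$ of hyperedges. The star of $v\in V(H)$ is $E_v(H)=\{e\in E(H):v\in e\}$. A unit of $H$ is an equivalence class of the relation $u\sim v\iff E_u(H)=E_v(H)$ on $V(H)$. The incidence matrix $I_H=[i_{ve}]_{v\in V(H),e\in E(H)}$ has $i_{ve}=1$ if $v\in e$ and $0$ otherwise. The incidence graph $G_H$ is the bipartite graph on the disjoint union $V(G_H)=V(H)\sqcup E(H)$ in which $v\in V(H)$ and $e\in E(H)$ are adjacent iff $v\in e$; its adjacency matrix is $A_{G_H}=\begin{bmatrix}0&I_H\\ I_H^T&0\end{bmatrix}$, acting on $\mathbb{R}^{V(G_H)}$. For non-empty $W\subseteq V(H)$, $S_W=\{f\in\mathbb{R}^{V(H)}: f(v)=0\text{ for all }v\in V(H)\setminus W,\ \sum_{w\in W}f(w)=0\}$. For $x\in\mathbb{R}^{V(H)}$, $\tilde x\in\mathbb{R}^{V(G_H)}$ is its extension by zero on $E(H)$, and $\tilde S_W=\{\tilde x:x\in S_W\}$. "$W$ is maximal such that $\tilde S_W$ has property $\mathcal{P}$" means that $\tilde S_W$ has property $\mathcal{P}$ and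 there is no $W'$ with $W\subsetneq W'\subseteq V(H)$ such that $\tilde S_{W'}$ has property $\mathcal{P}$. *)

theory Defs
  imports
    "Jordan_Normal_Form.Char_Poly"
    "Jordan_Normal_Form.Matrix_Kernel"
begin

(* The ambient type 'a may be larger than the vertex set, and the empty set is allowed
   as a hyperedge. *)
locale hypergraph =
  fixes V :: "'a set" and E :: "'a set set"
  assumes finite_verts: "finite V"
    and verts_nonempty: "V \<noteq> {}"
    and edges_subset: "E \<subseteq> Pow V"

definition star :: "'a set set \<Rightarrow> 'a \<Rightarrow> 'a set set" where
  "star E v = {e \<in> E. v \<in> e}"

definition unit_rel :: "'a set \<Rightarrow> 'a set set \<Rightarrow> ('a \<times> 'a) set" where
  "unit_rel V E = {(u, v) \<in> V \<times> V. star E u = star E v}"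

definition hypergraph_unit :: "'a set \<Rightarrow> 'a set set \<Rightarrow> 'a set \<Rightarrow> bool" where
  "hypergraph_unit V E W \<longleftrightarrow> W \<in> V // unit_rel V E"

definition incidence_graph_verts :: "'a set \<Rightarrow> 'a set set \<Rightarrow> ('a + 'a set) set" where
  "incidence_graph_verts V E = V <+> E"

definition incidence_graph_adj ::
    "'a set \<Rightarrow> 'a set set \<Rightarrow> 'a + 'a set \<Rightarrow> 'a + 'a set \<Rightarrow> bool" where
  "incidence_graph_adj V E x y \<longleftrightarrow>
    (\<exists>v\<in>V. \<exists>e\<in>E. v \<in> e \<and> (x = Inl v \<and> y = Inr e \<or> x = Inr e \<and> y = Inl v))"

(* Matrices and vectors are indexed by {0..<n}. Those indexed by the vertices of the
   incidence graph are read off along a list xs enumerating these vertices without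
   repetition. *)
definition enumerates :: "'b list \<Rightarrow> 'b set \<Rightarrow> bool" where
  "enumerates xs X \<longleftrightarrow> distinct xs \<and> set xs = X"

definition adjacency_mat :: "('b \<Rightarrow> 'b \<Rightarrow> bool) \<Rightarrow> 'b list \<Rightarrow> real mat" where
  "adjacency_mat adj xs =
    mat (length xs) (length xs) (\<lambda>(i, j). if adj (xs ! i) (xs ! j) then 1 else 0)"

definition incidence_graph_mat ::
    "'a set \<Rightarrow> 'a set set \<Rightarrow> ('a + 'a set) list \<Rightarrow> real mat" where
  "incidence_graph_mat V E xs = adjacency_mat (incidence_graph_adj V E) xs"

definition vec_of_fun :: "'b list \<Rightarrow> ('b \<Rightarrow> real) \<Rightarrow> real vec" where
  "vec_of_fun xs f = vec (length xs) (\<lambda>i. f (xs ! i))"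

(* A real function on the vertex set V is represented by a total function vanishing
   outside V; for W \<subseteq> V, vanishing outside W covers both this convention and
   vanishing on V - W. *)
definition zero_sum_space :: "'a set \<Rightarrow> ('a \<Rightarrow> real) set" where
  "zero_sum_space W = {f. (\<forall>v. v \<notin> W \<longrightarrow> f v = 0) \<and> (\<Sum>w\<in>W. f w) = 0}"

definition extend_by_zero :: "('a \<Rightarrow> real) \<Rightarrow> 'a + 'a set \<Rightarrow> real" where
  "extend_by_zero f = case_sum f (\<lambda>_. 0)"

definition extended_zero_sum_space :: "('a + 'a set) list \<Rightarrow> 'a set \<Rightarrow> real vec set" where
  "extended_zero_sum_space xs W = (\<lambda>f. vec_of_fun xs (extend_by_zero f)) ` zero_sum_space W"

definition subspace_of_nullspace :: "real vec set \<Rightarrow> real mat \<Rightarrow> bool" where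
  "subspace_of_nullspace S A \<longleftrightarrow>
    VectorSpace.subspace class_ring S
      ((module_vec TYPE(real) (dim_col A))\<lparr>carrier := mat_kernel A\<rparr>)"

definition maximal_subset_such_that :: "'a set \<Rightarrow> 'a set \<Rightarrow> ('a set \<Rightarrow> bool) \<Rightarrow> bool" where
  "maximal_subset_such_that V W P \<longleftrightarrow>
    W \<subseteq> V \<and> P W \<and> \<not> (\<exists>W'. W \<subset> W' \<and> W' \<subseteq> V \<and> P W')"

(* For an enumeration listing the vertices of the hypergraph before its hyperedges, the
   adjacency matrix has the usual block form. *)
definition incidence_mat :: "'a list \<Rightarrow> 'a set list \<Rightarrow> real mat" where
  "incidence_mat vs es =
    mat (length vs) (length es) (\<lambda>(i, j). if vs ! i \<in> es ! j then 1 else 0)"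

lemma incidence_graph_mat_block:
  assumes "set vs = V" "set es = E"
  shows "incidence_graph_mat V E (map Inl vs @ map Inr es) =
    four_block_mat (0\<^sub>m (length vs) (length vs)) (incidence_mat vs es)
      (transpose_mat (incidence_mat vs es)) (0\<^sub>m (length es) (length es))"
proof (rule eq_matI, goal_cases)
  case (1 i j)
  then have "i < length vs + length es" "j < length vs + length es"
    by (auto simp: incidence_mat_def)
  moreover have "k - length vs < length es"
    if "k < length vs + length es" "\<not> k < length vs" for k
    using that by linarith
  ultimately show ?case
    using assms
    by (cases "i < length vs"; cases "j < length vs")
      (auto simp: incidence_graph_mat_def adjacency_mat_def incidence_graph_adj_def
        incidence_mat_def nth_append)
qed (auto simp: incidence_graph_mat_def adjacency_mat_def incidence_mat_def)

end

theory Submission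
  imports Defs
begin

text \<open>
  Multiplying the adjacency matrix of the incidence graph with the extension of a function
  \<open>f\<close> on the vertices yields the vector whose entry at a hyperedge \<open>e\<close> is the sum of \<open>f\<close> over
  \<open>e\<close>, and which vanishes at the vertices. So the extension lies in the nullspace iff \<open>f\<close> sums
  to zero over every hyperedge (\<open>extend_by_zero_in_kernel_iff\<close>). For which \<open>U\<close> does this hold
  for all \<open>f\<close> of sum zero supported in \<open>U\<close>? If all elements of \<open>U\<close> have the same star, then a
  hyperedge contains all of \<open>U\<close> or none of it, and the sum of \<open>f\<close> over the hyperedge is its
  total sum, zero, or an empty sum. Conversely, the function that is \<open>1\<close> at \<open>u\<close>, \<open>-1\<close> at \<open>v\<close>
  and \<open>0\<close> elsewhere sums to zero over all hyperedges only if the stars of \<open>u\<close> and \<open>v\<close> agree.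
  Hence the nullspace property of \<open>U\<close> says exactly that \<open>U\<close> lies within a single unit
  (\<open>subspace_of_nullspace_iff\<close>), and the maximal sets with this property are the units
  (\<open>hypergraph_unit_iff_maximal\<close>).

  It remains to see that a unit \<open>W\<close> gives the eigenvalue \<open>0\<close> with algebraic multiplicity at
  least \<open>card W - 1\<close>. The rows of the adjacency matrix at the elements of \<open>W\<close> coincide.
  Fix \<open>w\<close> in \<open>W\<close> and, in the characteristic matrix, subtract the row of \<open>w\<close> from
  those of the other elements of \<open>W\<close>. This does not change the determinant and makes every
  entry of these \<open>card W - 1\<close> rows divisible by the indeterminate, so the characteristic
  polynomial is divisible by its power of exponent \<open>card W - 1\<close> (\<open>order_char_poly_equal_rows\<close>).
  The eigenvalue itself is witnessed by the vector that is \<open>1\<close> and \<open>-1\<close> at two elements of \<open>W\<close>.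
\<close>

section \<open>Equal rows and the multiplicity of the eigenvalue zero\<close>

lemma power_dvd_det:
  fixes A :: "'a :: comm_ring_1 mat"
  assumes A: "A \<in> carrier_mat n n"
    and S: "S \<subseteq> {0..<n}"
    and dvd: "\<And>i j. i \<in> S \<Longrightarrow> j < n \<Longrightarrow> c dvd A $$ (i, j)"
  shows "c ^ card S dvd det A"
  unfolding det_def'[OF A]
proof (intro dvd_sum dvd_mult)
  fix p assume "p \<in> {p. p permutes {0..<n}}"
  then have p: "p i < n" if "i < n" for i
    using that permutes_in_image[of p "{0..<n}" i] by simp
  have "c ^ card S = (\<Prod>i\<in>S. c)"
    by simp
  also have "\<dots> dvd (\<Prod>i\<in>S. A $$ (i, p i))"
    using S p by (intro prod_dvd_prod dvd) auto
  also have "\<dots> dvd (\<Prod>i = 0..<n. A $$ (i, p i))"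
    using S by (intro prod_dvd_prod_subset) auto
  finally show "c ^ card S dvd (\<Prod>i = 0..<n. A $$ (i, p i))" .
qed

lemma det_subtract_row:
  fixes A :: "'a :: comm_ring_1 mat"
  assumes A: "A \<in> carrier_mat n n"
    and S: "S \<subseteq> {0..<n}" and k: "k < n" "k \<notin> S"
  shows "det (mat n n (\<lambda>(i, j). if i \<in> S then A $$ (i, j) - A $$ (k, j) else A $$ (i, j))) =
    det A"
    (is "det (?B S) = _")
proof -
  have "finite S"
    using S finite_subset by blast
  then show ?thesis
    using S k(2)
  proof (induction S)
    case empty
    have "?B {} = A"
      using A by (intro eq_matI) auto
    then show ?case by simp
  next
    case (insert s S)
    have "?B (insert s S) = addrow (-1) s k (?B S)"
      using insert k by (intro eq_matI) auto
    then have "det (?B (insert s S)) = det (?B S)"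
      using insert k by (simp add: det_addrow[of k n s])
    then show ?case
      using insert by simp
  qed
qed

text \<open>
  In the difference of two rows of the characteristic matrix the entries of two equal rows of
  \<open>A\<close> cancel, and only the contributions of the diagonal matrix, multiples of the indeterminate,
  survive.
\<close>

lemma order_char_poly_equal_rows:
  fixes A :: "'a :: field mat"
  assumes A: "A \<in> carrier_mat n n"
    and S: "S \<subseteq> {0..<n}" and k: "k < n" "k \<notin> S"
    and eq: "\<And>i j. i \<in> S \<Longrightarrow> j < n \<Longrightarrow> A $$ (i, j) = A $$ (k, j)"
  shows "card S \<le> Polynomial.order 0 (char_poly A)"
proof -
  let ?C = "char_poly_matrix A"
  let ?B = "mat n n (\<lambda>(i, j). if i \<in> S then ?C $$ (i, j) - ?C $$ (k, j) else ?C $$ (i, j))"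
  have C: "?C \<in> carrier_mat n n"
    using A by simp
  have "[:0, 1:] ^ card S dvd det ?B"
  proof (rule power_dvd_det[OF _ S])
    fix i j assume ij: "i \<in> S" "j < n"
    then have "i < n"
      using S by auto
    then have "?B $$ (i, j) =
        [:0, 1:] * ((if i = j then 1 else 0) - (if k = j then 1 else 0))"
      using ij A k eq[OF ij] by (auto simp: char_poly_matrix_def)
    then show "[:0, 1:] dvd ?B $$ (i, j)"
      by (rule dvdI)
  qed simp
  \<comment> \<open>The indeterminate is the linear factor of the root \<open>0\<close>.\<close>
  then have "[:- 0, 1:] ^ card S dvd char_poly A"
    using det_subtract_row[OF C S k] by (simp add: char_poly_def)
  moreover have "char_poly A \<noteq> 0"
    using degree_monic_char_poly[OF A] by auto
  ultimately show ?thesis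
    by (subst (asm) order_divides) simp
qed

section \<open>The nullspace of the adjacency matrix of the incidence graph\<close>

lemma incidence_graph_mat_carrier [simp]:
  "incidence_graph_mat V E xs \<in> carrier_mat (length xs) (length xs)"
  by (simp add: incidence_graph_mat_def adjacency_mat_def)

lemma sum_enumerates:
  assumes "enumerates xs X"
  shows "(\<Sum>i = 0..<length xs. g (xs ! i)) = sum g X"
proof -
  have "bij_betw ((!) xs) {0..<length xs} X"
    using assms bij_betw_nth[of xs "{0..<length xs}" X]
    by (auto simp: enumerates_def atLeast0LessThan)
  then show ?thesis
    by (rule sum.reindex_bij_betw)
qed

lemma index_incidence_graph_mat_mult_extend_by_zero:
  assumes fin: "finite V" "finite E"
    and xs: "enumerates xs (incidence_graph_verts V E)"
    and i: "i < length xs"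
  shows "(incidence_graph_mat V E xs *\<^sub>v vec_of_fun xs (extend_by_zero f)) $ i =
    (case xs ! i of Inl _ \<Rightarrow> 0 | Inr e \<Rightarrow> sum f (V \<inter> e))"
proof -
  let ?a = "\<lambda>y. (if incidence_graph_adj V E (xs ! i) y then 1 else 0) * extend_by_zero f y"
  have "xs ! i \<in> V <+> E"
    using xs i nth_mem[of i xs] by (auto simp: enumerates_def incidence_graph_verts_def)
  then have x: "e \<in> E" if "xs ! i = Inr e" for e
    using that by auto
  have "(incidence_graph_mat V E xs *\<^sub>v vec_of_fun xs (extend_by_zero f)) $ i =
      (\<Sum>j = 0..<length xs. ?a (xs ! j))"
    using i by (simp add: incidence_graph_mat_def adjacency_mat_def vec_of_fun_def scalar_prod_def)
  also have "\<dots> = sum ?a (V <+> E)"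
    using sum_enumerates[OF xs] by (simp add: incidence_graph_verts_def)
  also have "\<dots> = (\<Sum>v\<in>V. ?a (Inl v))"
    using fin by (simp add: sum.Plus extend_by_zero_def)
  also have "\<dots> = (case xs ! i of Inl _ \<Rightarrow> 0 | Inr e \<Rightarrow> sum f (V \<inter> e))"
  proof (cases "xs ! i")
    case (Inl u)
    then show ?thesis
      by (simp add: incidence_graph_adj_def)
  next
    case (Inr e)
    then have "(\<Sum>v\<in>V. ?a (Inl v)) = (\<Sum>v\<in>V. if v \<in> e then f v else 0)"
      using x by (intro sum.cong) (auto simp: incidence_graph_adj_def extend_by_zero_def)
    then show ?thesis
      using Inr fin by (simp add: sum.inter_restrict)
  qed
  finally show ?thesis .
qed

lemma extend_by_zero_in_kernel_iff:
  assumes fin: "finite V" "finite E"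
    and xs: "enumerates xs (incidence_graph_verts V E)"
  shows "vec_of_fun xs (extend_by_zero f) \<in> mat_kernel (incidence_graph_mat V E xs) \<longleftrightarrow>
    (\<forall>e\<in>E. sum f (V \<inter> e) = 0)"
    (is "?x \<in> mat_kernel ?A \<longleftrightarrow> _")
proof -
  have "?x \<in> carrier_vec (length xs)"
    by (simp add: vec_of_fun_def)
  then have "?x \<in> mat_kernel ?A \<longleftrightarrow> ?A *\<^sub>v ?x = 0\<^sub>v (length xs)"
    using mat_kernel[of ?A "length xs" "length xs"] by simp
  also have "\<dots> \<longleftrightarrow> (\<forall>i<length xs. (?A *\<^sub>v ?x) $ i = 0)"
    using carrier_matD(1)[of ?A "length xs" "length xs"] by (auto simp: vec_eq_iff)
  also have "\<dots> \<longleftrightarrow> (\<forall>y\<in>set xs. (case y of Inl _ \<Rightarrow> 0 | Inr e \<Rightarrow> sum f (V \<inter> e)) = 0)"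
    using index_incidence_graph_mat_mult_extend_by_zero[OF fin xs] by (simp add: all_set_conv_all_nth)
  also have "\<dots> \<longleftrightarrow> (\<forall>e\<in>E. sum f (V \<inter> e) = 0)"
    using xs by (auto simp: enumerates_def incidence_graph_verts_def Plus_def ball_Un)
  finally show ?thesis .
qed

definition point_difference :: "'a \<Rightarrow> 'a \<Rightarrow> 'a \<Rightarrow> real" where
  "point_difference u v w = of_bool (w = u) - of_bool (w = v)"

lemma sum_point_difference:
  "finite X \<Longrightarrow> sum (point_difference u v) X = of_bool (u \<in> X) - of_bool (v \<in> X)"
  by (simp add: point_difference_def sum_subtractf of_bool_def)

lemma point_difference_in_zero_sum_space:
  "finite U \<Longrightarrow> u \<in> U \<Longrightarrow> v \<in> U \<Longrightarrow> point_difference u v \<in> zero_sum_space U"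
  by (auto simp: zero_sum_space_def sum_point_difference) (auto simp: point_difference_def)

text \<open>
  A hyperedge on which all functions of sum zero on \<open>U\<close> cancel cannot separate two points of
  \<open>U\<close>, as the difference of these points shows; a hyperedge that separates no points contains
  all of \<open>U\<close> or misses it.
\<close>

lemma extended_zero_sum_space_subset_kernel_iff:
  assumes fin: "finite V" "finite E" and U: "U \<subseteq> V"
    and xs: "enumerates xs (incidence_graph_verts V E)"
  shows "extended_zero_sum_space xs U \<subseteq> mat_kernel (incidence_graph_mat V E xs) \<longleftrightarrow>
    (\<forall>u\<in>U. \<forall>v\<in>U. star E u = star E v)"
proof -
  have finU: "finite U"
    using U fin finite_subset by blast
  have "extended_zero_sum_space xs U \<subseteq> mat_kernel (incidence_graph_mat V E xs) \<longleftrightarrow>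
      (\<forall>f\<in>zero_sum_space U. \<forall>e\<in>E. sum f (V \<inter> e) = 0)"
    using extend_by_zero_in_kernel_iff[OF fin xs]
    by (simp add: extended_zero_sum_space_def image_subset_iff)
  also have "\<dots> \<longleftrightarrow> (\<forall>u\<in>U. \<forall>v\<in>U. star E u = star E v)"
  proof (intro iffI ballI)
    fix u v
    assume *: "\<forall>f\<in>zero_sum_space U. \<forall>e\<in>E. sum f (V \<inter> e) = 0" and uv: "u \<in> U" "v \<in> U"
    have "u \<in> e \<longleftrightarrow> v \<in> e" if "e \<in> E" for e
    proof -
      have "sum (point_difference u v) (V \<inter> e) = 0"
        using * point_difference_in_zero_sum_space[OF finU uv] that by blast
      then show ?thesis
        using U uv fin by (auto simp: sum_point_difference of_bool_def split: if_splits)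
    qed
    then show "star E u = star E v"
      by (auto simp: star_def)
  next
    fix f e
    assume star: "\<forall>u\<in>U. \<forall>v\<in>U. star E u = star E v" and f: "f \<in> zero_sum_space U" and "e \<in> E"
    then have "U \<inter> e = U \<or> U \<inter> e = {}"
      unfolding star_def by blast
    then have "sum f (U \<inter> e) = 0"
      using f by (auto simp: zero_sum_space_def)
    moreover have "sum f (V \<inter> e) = sum f (U \<inter> e)"
      using U fin f by (intro sum.mono_neutral_right) (auto simp: zero_sum_space_def)
    ultimately show "sum f (V \<inter> e) = 0"
      by simp
  qed
  finally show ?thesis .
qed

text \<open>
  The closure conditions of a subspace always hold, because \<open>zero_sum_space U\<close> is closed under
  linear combinations, and extending a function by zero and listing its values are linear
  operations.
\<close>

lemma subspace_of_nullspace_extended_zero_sum_space_iff: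
  assumes A: "A \<in> carrier_mat n (length xs)"
  shows "subspace_of_nullspace (extended_zero_sum_space xs U) A \<longleftrightarrow>
    extended_zero_sum_space xs U \<subseteq> mat_kernel A"
    (is "_ \<longleftrightarrow> ?S \<subseteq> _")
proof
  assume "subspace_of_nullspace ?S A"
  then show "?S \<subseteq> mat_kernel A"
    unfolding subspace_of_nullspace_def VectorSpace.subspace_def
      LinearCombinations.submodule_def by simp
next
  interpret K: kernel n "length xs" A
    by unfold_locales (rule A)
  assume sub: "?S \<subseteq> mat_kernel A"
  have zero: "0\<^sub>v (length xs) \<in> ?S"
    unfolding extended_zero_sum_space_def
    by (rule image_eqI[of _ _ "\<lambda>_. 0"])
      (auto simp: zero_sum_space_def vec_of_fun_def extend_by_zero_def split: sum.splits)
  have add: "x + y \<in> ?S" if xy: "x \<in> ?S" "y \<in> ?S" for x y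
  proof -
    obtain f g where "f \<in> zero_sum_space U" "x = vec_of_fun xs (extend_by_zero f)"
      "g \<in> zero_sum_space U" "y = vec_of_fun xs (extend_by_zero g)"
      using xy by (auto simp: extended_zero_sum_space_def)
    then show ?thesis
      unfolding extended_zero_sum_space_def
      by (intro image_eqI[of _ _ "\<lambda>v. f v + g v"])
        (auto simp: zero_sum_space_def vec_of_fun_def extend_by_zero_def sum.distrib
          split: sum.splits)
  qed
  have smult: "c \<cdot>\<^sub>v x \<in> ?S" if x: "x \<in> ?S" for c x
  proof -
    obtain f where "f \<in> zero_sum_space U" "x = vec_of_fun xs (extend_by_zero f)"
      using x by (auto simp: extended_zero_sum_space_def)
    then show ?thesis
      unfolding extended_zero_sum_space_def
      by (intro image_eqI[of _ _ "\<lambda>v. c * f v"])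
        (auto simp: zero_sum_space_def vec_of_fun_def extend_by_zero_def
          sum_distrib_left[symmetric] split: sum.splits)
  qed
  have "VectorSpace.subspace class_ring ?S K.VK"
    using sub zero add smult
    by (intro VectorSpace.subspace.intro submodule.intro K.Ker.vectorspace_axioms
        K.Ker.module_axioms) auto
  then show "subspace_of_nullspace ?S A"
    using A by (simp add: subspace_of_nullspace_def)
qed

lemma subspace_of_nullspace_iff:
  assumes "finite V" "finite E" "U \<subseteq> V"
    and "enumerates xs (incidence_graph_verts V E)"
  shows "subspace_of_nullspace (extended_zero_sum_space xs U) (incidence_graph_mat V E xs) \<longleftrightarrow>
    (\<forall>u\<in>U. \<forall>v\<in>U. star E u = star E v)"
  unfolding subspace_of_nullspace_extended_zero_sum_space_iff[OF incidence_graph_mat_carrier]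
  by (rule extended_zero_sum_space_subset_kernel_iff[OF assms])

section \<open>Units\<close>

lemma equiv_unit_rel: "equiv V (unit_rel V E)"
  by (auto simp: equiv_def refl_on_def sym_def trans_def unit_rel_def)

lemma hypergraph_unit_iff:
  assumes "W \<subseteq> V" "w \<in> W"
  shows "hypergraph_unit V E W \<longleftrightarrow> W = {v \<in> V. star E v = star E w}"
proof -
  have class_w: "unit_rel V E `` {w} = {v \<in> V. star E v = star E w}"
    using assms by (auto simp: unit_rel_def)
  have "hypergraph_unit V E W \<longleftrightarrow> W = unit_rel V E `` {w}"
    unfolding hypergraph_unit_def
    using assms Image_singleton_iff equiv_class_eq[OF equiv_unit_rel]
    by (metis equiv_unit_rel quotientE quotientI subset_iff)
  then show ?thesis
    by (simp add: class_w)
qed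

lemma hypergraph_unit_iff_maximal:
  assumes "W \<subseteq> V" "w \<in> W"
  shows "hypergraph_unit V E W \<longleftrightarrow>
    maximal_subset_such_that V W (\<lambda>U. \<forall>u\<in>U. \<forall>v\<in>U. star E u = star E v)"
    (is "_ \<longleftrightarrow> maximal_subset_such_that V W ?P")
proof -
  let ?C = "{v \<in> V. star E v = star E w}"
  have "?P ?C"
    by simp
  moreover have "U \<subseteq> ?C" if "?P U" "W \<subseteq> U" "U \<subseteq> V" for U
    using that assms by blast
  ultimately have "maximal_subset_such_that V W ?P \<longleftrightarrow> W = ?C"
    unfolding maximal_subset_such_that_def using assms
    by (smt (verit) mem_Collect_eq order_refl psubset_eq subset_antisym subsetI)
  then show ?thesis
    using hypergraph_unit_iff[OF assms] by simp
qed

lemma eigenvalue_zero_incidence_graph_mat: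
  assumes fin: "finite V" "finite E"
    and uv: "u \<in> V" "v \<in> V" "u \<noteq> v" "star E u = star E v"
    and xs: "enumerates xs (incidence_graph_verts V E)"
  shows "eigenvalue (incidence_graph_mat V E xs) 0"
proof -
  let ?A = "incidence_graph_mat V E xs"
  let ?x = "vec_of_fun xs (extend_by_zero (point_difference u v))"
  have x: "?x \<in> carrier_vec (length xs)"
    by (simp add: vec_of_fun_def)
  have "Inl u \<in> set xs"
    using xs uv by (auto simp: enumerates_def incidence_graph_verts_def)
  then obtain i where i: "i < length xs" "xs ! i = Inl u"
    by (auto simp: in_set_conv_nth)
  then have "?x $ i = 1"
    using uv by (simp add: vec_of_fun_def extend_by_zero_def point_difference_def)
  then have "?x \<noteq> 0\<^sub>v (length xs)"
    using i by auto
  moreover have ker: "?x \<in> mat_kernel ?A"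
    using uv fin unfolding extend_by_zero_in_kernel_iff[OF fin xs]
    by (auto simp: sum_point_difference star_def of_bool_def)
  then have "?A *\<^sub>v ?x = 0 \<cdot>\<^sub>v ?x"
    using mat_kernelD(2)[OF incidence_graph_mat_carrier ker] x by auto
  ultimately have "eigenvector ?A ?x 0"
    using x carrier_matD(1)[OF incidence_graph_mat_carrier, of V E xs]
    by (simp add: eigenvector_def)
  then show ?thesis
    by (auto simp: eigenvalue_def)
qed

lemma order_char_poly_incidence_graph_mat:
  assumes W: "W \<subseteq> V" "finite W"
    and star: "\<And>u v. u \<in> W \<Longrightarrow> v \<in> W \<Longrightarrow> star E u = star E v"
    and xs: "enumerates xs (incidence_graph_verts V E)"
  shows "card W - 1 \<le> Polynomial.order 0 (char_poly (incidence_graph_mat V E xs))"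
proof (cases "W = {}")
  case False
  then obtain w where w: "w \<in> W"
    by auto
  have verts: "Inl v \<in> set xs" if "v \<in> W" for v
    using that W xs by (auto simp: enumerates_def incidence_graph_verts_def)
  obtain k where k: "k < length xs" "xs ! k = Inl w"
    using verts[OF w] by (auto simp: in_set_conv_nth)
  define S where "S = {i. i < length xs \<and> xs ! i \<in> Inl ` (W - {w})}"
  have "bij_betw ((!) xs) S (Inl ` (W - {w}))"
  proof (rule bij_betw_imageI)
    show "inj_on ((!) xs) S"
      using xs by (auto simp: S_def inj_on_def enumerates_def nth_eq_iff_index_eq)
    show "(!) xs ` S = Inl ` (W - {w})"
      using verts by (fastforce simp: S_def in_set_conv_nth image_iff)
  qed
  then have "card S = card (Inl ` (W - {w}) :: ('a + 'a set) set)"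
    by (rule bij_betw_same_card)
  also have "\<dots> = card W - 1"
    using w W by (simp add: card_image)
  finally have "card S = card W - 1" .
  moreover have "card S \<le> Polynomial.order 0 (char_poly (incidence_graph_mat V E xs))"
  proof (rule order_char_poly_equal_rows[OF incidence_graph_mat_carrier])
    show "S \<subseteq> {0..<length xs}" "k < length xs" "k \<notin> S"
      using k by (auto simp: S_def)
    fix i j assume ij: "i \<in> S" "j < length xs"
    then obtain v where v: "v \<in> W" "xs ! i = Inl v" "i < length xs"
      by (auto simp: S_def)
    have "incidence_graph_adj V E (Inl v) y = incidence_graph_adj V E (Inl w) y" for y
      using star[OF v(1) w] v w W by (auto simp: incidence_graph_adj_def star_def)
    then show "incidence_graph_mat V E xs $$ (i, j) = incidence_graph_mat V E xs $$ (k, j)"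
      using ij v k by (simp add: incidence_graph_mat_def adjacency_mat_def)
  qed
  ultimately show ?thesis
    by simp
qed simp

theorem theorem2p15:
  fixes V :: "'a set" and E :: "'a set set" and W :: "'a set"
    and xs :: "('a + 'a set) list"
  assumes "hypergraph V E"
    and "W \<subseteq> V"
    and "card W \<ge> 2"
    and "enumerates xs (incidence_graph_verts V E)"
  shows "hypergraph_unit V E W \<longleftrightarrow>
    eigenvalue (incidence_graph_mat V E xs) 0 \<and>
    Polynomial.order 0 (char_poly (incidence_graph_mat V E xs)) \<ge> card W - 1 \<and>
    maximal_subset_such_that V W
      (\<lambda>U. subspace_of_nullspace (extended_zero_sum_space xs U) (incidence_graph_mat V E xs))"
proof -
  interpret hypergraph V E
    by (rule assms(1))
  have finE: "finite E"
    using edges_subset finite_verts finite_subset by blast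
  have finW: "finite W"
    using assms(2) finite_verts finite_subset by blast
  obtain u v where uv: "u \<in> W" "v \<in> W" "u \<noteq> v"
    using assms(3) card_le_Suc0_iff_eq[OF finW] by auto
  let ?P = "\<lambda>U. \<forall>u\<in>U. \<forall>v\<in>U. star E u = star E v"
  have "maximal_subset_such_that V W
      (\<lambda>U. subspace_of_nullspace (extended_zero_sum_space xs U) (incidence_graph_mat V E xs)) \<longleftrightarrow>
      maximal_subset_such_that V W ?P"
    unfolding maximal_subset_such_that_def
    by (simp add: subspace_of_nullspace_iff[OF finite_verts finE _ assms(4)] assms(2)
        cong: conj_cong)
  also have "\<dots> \<longleftrightarrow> hypergraph_unit V E W"
    using hypergraph_unit_iff_maximal[OF assms(2) uv(1)] by simp
  finally have max: "maximal_subset_such_that V W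
      (\<lambda>U. subspace_of_nullspace (extended_zero_sum_space xs U) (incidence_graph_mat V E xs)) \<longleftrightarrow>
      hypergraph_unit V E W" .
  moreover have "eigenvalue (incidence_graph_mat V E xs) 0 \<and>
      Polynomial.order 0 (char_poly (incidence_graph_mat V E xs)) \<ge> card W - 1"
    if "hypergraph_unit V E W"
  proof -
    have star: "star E a = star E b" if "a \<in> W" "b \<in> W" for a b
      using that \<open>hypergraph_unit V E W\<close>
        hypergraph_unit_iff[OF assms(2) uv(1)] by auto
    have "u \<in> V" "v \<in> V"
      using uv assms(2) by auto
    then show ?thesis
      using eigenvalue_zero_incidence_graph_mat[OF finite_verts finE _ _ uv(3) star assms(4)] uv
        order_char_poly_incidence_graph_mat[OF assms(2) finW star assms(4)] by simp
  qed
  ultimately show ?thesis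
    by blast
qed

end
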